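(* Let $\mathcal{V}$ be a primitive subspace of $\mathcal{J}_3(\mathbb{F}_2)$ with dimension $3$. Then $\mathcal{V}$ is equivalent to one and only one of the four spaces associated with the generic matrices $$\mathbf{M}_1:=\begin{bmatrix}\mathbf{a}&0&\mathbf{c}\\0&\mathbf{a}+\mathbf{b}&0\\0&0&\mathbf{b}\end{bmatrix},\quad \mathbf{M}_2:=\begin{bmatrix}\mathbf{a}&\mathbf{c}&0\\0&\mathbf{a}+\mathbf{b}&\mathbf{a}\\0&0&\mathbf{b}\end{bmatrix},\quad \mathbf{M}_3:=\begin{bmatrix}\mathbf{a}&\mathbf{b}&0\\0&\mathbf{a}+\mathbf{b}&\mathbf{c}\\0&0&\mathbf{b}\end{bmatrix},\quad \mathbf{M}_4:=\begin{bmatrix}\mathbf{a}&\mathbf{c}&0\\0&\mathbf{a}+\mathbf{b}&\mathbf{c}\\0&0&\mathbf{b}\end{bmatrix}.$$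
   Context: $\mathrm{M}_{n,p}(\mathbb{K})$ is the space of $n\times p$ matrices over a field $\mathbb{K}$, and $\mathrm{M}_n(\mathbb{K})=\mathrm{M}_{n,n}(\mathbb{K})$. The upper rank $\operatorname{urk}(\mathcal{V})$ of a linear subspace $\mathcal{V}$ of $\mathrm{M}_{n,p}(\mathbb{K})$ is the maximal rank of a matrix in $\mathcal{V}$. Two linear subspaces $\mathcal{V}_1,\mathcal{V}_2$ of $\mathrm{M}_{n,p}(\mathbb{K})$ are equivalent when $\mathcal{V}_2=P\mathcal{V}_1Q$ for some $P\in\mathrm{GL}_n(\mathbb{K})$, $Q\in\mathrm{GL}_p(\mathbb{K})$. A linear subspace $\mathcal{V}$ of $\mathrm{M}_{n,p}(\mathbb{K})$ with upper rank $r$ is called primitive when: (i) no non-zero vector of $\mathbb{K}^p$ belongs to the kernel of every matrix of $\mathcal{V}$; (ii) the span of the ranges of all the matrices of $\mathcal{V}$ is $\mathbb{K}^n$; (iii) $\mathcal{V}$ is not equivalent to a space $\mathcal{T}$ of matrices of the form $M=\begin{bmatrix} H(M) & [?]_{n\times 1}\end{bmatrix}$ (so $H(M)\in\mathrm{M}_{n,p-1}(\mathbb{K})$) where $\operatorname{urk}H(\mathcal{T})\leq r-1$; (iv) $\mathcal{V}$ is not equivalent to a space $\mathcal{T}$ of matrices of the form $M=\begin{bmatrix} H(M)\\ [?]_{1\times p}\end{bmatrix}$ (so $H(M)\in\mathrm{M}_{n-1,p}(\mathbb{K})$) where $\operatorname{urk}H(\mathcal{T})\leq r-1$. $\mathcal{J}_3(\mathbb{F}_2)$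 is the space of all upper-triangular $3\times 3$ matrices over $\mathbb{F}_2$ with trace zero. The space associated with a generic matrix in the independent indeterminates $\mathbf{a},\mathbf{b},\mathbf{c}$ is the linear subspace of $\mathrm{M}_3(\mathbb{F}_2)$ consisting of all matrices obtained by substituting arbitrary elements of $\mathbb{F}_2$ for the indeterminates. *)

theory Defs
  imports "Jordan_Normal_Form.DL_Rank" "Jordan_Normal_Form.Matrix_Kernel" "HOL-Library.Z2"
begin

definition mat_subspace :: "nat \<Rightarrow> nat \<Rightarrow> 'a :: field mat set \<Rightarrow> bool" where
  "mat_subspace n p V \<longleftrightarrow> VectorSpace.subspace class_ring V (module_mat TYPE('a) n p)"

definition mat_space_dim :: "nat \<Rightarrow> nat \<Rightarrow> 'a :: field mat set \<Rightarrow> nat" where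
  "mat_space_dim n p V = vectorspace.dim class_ring ((module_mat TYPE('a) n p)\<lparr>carrier := V\<rparr>)"

(* n is the number of rows, as required by vec_space.rank *)
definition urk :: "nat \<Rightarrow> 'a :: field mat set \<Rightarrow> nat" where
  "urk n V = Max (vec_space.rank n ` V)"

definition GL :: "nat \<Rightarrow> 'a :: field mat set" where
  "GL n = {P \<in> carrier_mat n n. invertible_mat P}"

definition mat_equivalent :: "nat \<Rightarrow> nat \<Rightarrow> 'a :: field mat set \<Rightarrow> 'a mat set \<Rightarrow> bool" where
  "mat_equivalent n p V1 V2 \<longleftrightarrow> (\<exists>P \<in> GL n. \<exists>Q \<in> GL p. V2 = (\<lambda>M. P * M * Q) ` V1)"

definition drop_last_col :: "'a mat \<Rightarrow> 'a mat" where
  "drop_last_col M = mat (dim_row M) (dim_col M - 1) (\<lambda>(i, j). M $$ (i, j))"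

definition drop_last_row :: "'a mat \<Rightarrow> 'a mat" where
  "drop_last_row M = mat (dim_row M - 1) (dim_col M) (\<lambda>(i, j). M $$ (i, j))"

(* In the last two conditions, "urk H(T) <= r - 1" with r = urk V is written with "<", since
   subtraction on nat would truncate for r = 0. The block H(M) consists of the first p - 1
   columns (resp. the first n - 1 rows) of M; the remaining column (resp. row) is unconstrained. *)
definition primitive_space :: "nat \<Rightarrow> nat \<Rightarrow> 'a :: field mat set \<Rightarrow> bool" where
  "primitive_space n p V \<longleftrightarrow>
     mat_subspace n p V \<and>
     \<not> (\<exists>x \<in> carrier_vec p. x \<noteq> 0\<^sub>v p \<and> (\<forall>M \<in> V. x \<in> mat_kernel M)) \<and>
     LinearCombinations.module.span class_ring (module_vec TYPE('a) n)
       (\<Union>M \<in> V. (\<lambda>x. M *\<^sub>v x) ` carrier_vec p) = carrier_vec n \<and>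
     \<not> (\<exists>T. mat_equivalent n p V T \<and> urk n (drop_last_col ` T) < urk n V) \<and>
     \<not> (\<exists>T. mat_equivalent n p V T \<and> urk (n - 1) (drop_last_row ` T) < urk n V)"

(* The two-element field is the type bit. *)
definition J3 :: "bit mat set" where
  "J3 = {M \<in> carrier_mat 3 3. upper_triangular M \<and> (\<Sum>i < 3. M $$ (i, i)) = 0}"

definition M1 :: "bit \<Rightarrow> bit \<Rightarrow> bit \<Rightarrow> bit mat" where
  "M1 a b c = mat_of_rows_list 3
     [[a, 0,     c],
      [0, a + b, 0],
      [0, 0,     b]]"

definition M2 :: "bit \<Rightarrow> bit \<Rightarrow> bit \<Rightarrow> bit mat" where
  "M2 a b c = mat_of_rows_list 3
     [[a, c,     0],
      [0, a + b, a],
      [0, 0,     b]]"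

definition M3 :: "bit \<Rightarrow> bit \<Rightarrow> bit \<Rightarrow> bit mat" where
  "M3 a b c = mat_of_rows_list 3
     [[a, b,     0],
      [0, a + b, c],
      [0, 0,     b]]"

definition M4 :: "bit \<Rightarrow> bit \<Rightarrow> bit \<Rightarrow> bit mat" where
  "M4 a b c = mat_of_rows_list 3
     [[a, c,     0],
      [0, a + b, c],
      [0, 0,     b]]"

definition associated_space :: "(bit \<Rightarrow> bit \<Rightarrow> bit \<Rightarrow> bit mat) \<Rightarrow> bit mat set" where
  "associated_space G = {G a b c | a b c. True}"

end

theory Submission
  imports Defs
begin

text \<open>
  Every matrix of \<open>J3\<close> has diagonal \<open>(a, a + b, b)\<close>. Primitivity enters through one fact: a
  primitive \<open>V \<subseteq> J3\<close> attains all four diagonals (\<open>primitive_space_diagonals\<close>). Otherwise one of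
  the three linear forms \<open>a\<close>, \<open>b\<close>, \<open>a + b\<close> vanishes on \<open>V\<close>. If it is \<open>a\<close>, the first column is zero
  throughout \<open>V\<close>, giving a common kernel vector; if it is \<open>b\<close>, the last row is zero, and the ranges
  do not span. If it is \<open>a + b\<close> but not \<open>a\<close>, only the first row survives in the first two columns,
  so deleting the last column lowers the upper rank from \<open>2\<close> to at most \<open>1\<close>.

  When all diagonals occur and \<open>V\<close> has \<open>2 ^ 3\<close> elements, exactly two of them have zero diagonal, namely
  \<open>0\<close> and some strictly upper triangular \<open>N\<close>. Hence \<open>V\<close> is parametrised by \<open>a, b, c\<close>: the entries above
  the diagonal are linear forms in \<open>a, b\<close> plus \<open>c\<close> times the entries of \<open>N\<close>
  (\<open>primitive_eq_upper_family\<close>). The linear forms can be cleared by multiplying with unitriangular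
  matrices on both sides (\<open>upper_family_equivalent_diagonal\<close>). Independent row and column operations
  are allowed, and \<open>a + b\<close> together with either of \<open>a\<close>, \<open>b\<close> spans all linear forms, so the positions
  \<open>(1,2)\<close> and \<open>(2,3)\<close> are cleared by an adjacent row and column, and the corner by row 3 and column 1. The
  only trace left is a change of the corner entry of \<open>N\<close>. What remains are seven spaces
  \<open>diag(a, a + b, b) + c N\<close>. Three of them, those with a single non-zero entry in \<open>N\<close>, are equivalent
  to \<open>M1\<close> by permutations; the other four are reductions of \<open>M2\<close>, of \<open>M3\<close>, and of \<open>M4\<close> in two ways,
  the second one after the substitution \<open>c := c + b\<close> (\<open>diagonal_equivalent_M\<close>).

  To separate the four spaces, count the vectors \<open>x\<close> for which \<open>V x\<close> is at most one-dimensional, and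
  count likewise for the transposed space. Both numbers are invariants of equivalence
  (\<open>card_thin_equivalent\<close>). For \<open>M1\<close>, \<open>M2\<close>, \<open>M3\<close>, \<open>M4\<close> the pairs are \<open>(3, 3)\<close>, \<open>(2, 3)\<close>, \<open>(3, 2)\<close>,
  \<open>(2, 2)\<close>.
\<close>

section \<open>Bits, and three-by-three matrices by their entries\<close>

lemma bit_finite: "finite (UNIV :: bit set)" and bit_card: "card (UNIV :: bit set) = 2"
proof -
  have u: "UNIV = {0, 1 :: bit}"
    using bit_not_one_iff by blast
  show "finite (UNIV :: bit set)" "card (UNIV :: bit set) = 2"
    by (simp_all add: u)
qed

lemma all_bit: "(\<forall>x :: bit. P x) \<longleftrightarrow> P 0 \<and> P 1"
  by (metis bit_not_zero_iff)

lemma ex_bit: "(\<exists>x :: bit. P x) \<longleftrightarrow> P 0 \<or> P 1"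
  by (metis bit_not_zero_iff)

definition mat3 :: "'a \<Rightarrow> 'a \<Rightarrow> 'a \<Rightarrow> 'a \<Rightarrow> 'a \<Rightarrow> 'a \<Rightarrow> 'a \<Rightarrow> 'a \<Rightarrow> 'a \<Rightarrow> 'a mat" where
  "mat3 a b c d e f g h i = mat_of_rows_list 3 [[a, b, c], [d, e, f], [g, h, i]]"

definition vec3 :: "'a \<Rightarrow> 'a \<Rightarrow> 'a \<Rightarrow> 'a vec" where
  "vec3 x y z = vec 3 (\<lambda>i. [x, y, z] ! i)"

lemma less_3: "(i :: nat) < 3 \<longleftrightarrow> i = 0 \<or> i = 1 \<or> i = 2"
  by auto

lemma sum_3: "(\<Sum>i < 3. f i) = f 0 + f 1 + f (2 :: nat)" "sum f {0..<3} = f 0 + f 1 + f (2 :: nat)"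
  by (simp_all add: numeral_3_eq_3 numeral_2_eq_2)

lemma mat3_carrier [simp]: "mat3 a b c d e f g h i \<in> carrier_mat 3 3"
  by (simp add: mat3_def mat_of_rows_list_def carrier_matI)

lemma mat3_dim [simp]: "dim_row (mat3 a b c d e f g h i) = 3" "dim_col (mat3 a b c d e f g h i) = 3"
  by (simp_all add: mat3_def mat_of_rows_list_def)

lemma vec3_carrier [simp]: "vec3 x y z \<in> carrier_vec 3"
  by (simp add: vec3_def)

lemma vec3_dim [simp]: "dim_vec (vec3 x y z) = 3"
  by (simp add: vec3_def)

lemma mat3_index [simp]:
  "mat3 a b c d e f g h i $$ (0, 0) = a" "mat3 a b c d e f g h i $$ (0, Suc 0) = b"
  "mat3 a b c d e f g h i $$ (0, 2) = c" "mat3 a b c d e f g h i $$ (Suc 0, 0) = d"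
  "mat3 a b c d e f g h i $$ (Suc 0, Suc 0) = e" "mat3 a b c d e f g h i $$ (Suc 0, 2) = f"
  "mat3 a b c d e f g h i $$ (2, 0) = g" "mat3 a b c d e f g h i $$ (2, Suc 0) = h"
  "mat3 a b c d e f g h i $$ (2, 2) = i"
  by (simp_all add: mat3_def mat_of_rows_list_def)

lemma vec3_index [simp]:
  "vec3 x y z $ 0 = x" "vec3 x y z $ Suc 0 = y" "vec3 x y z $ 2 = z"
  by (simp_all add: vec3_def)

lemma mat3_eta:
  assumes "M \<in> carrier_mat 3 3"
  shows "M = mat3 (M $$ (0, 0)) (M $$ (0, 1)) (M $$ (0, 2)) (M $$ (1, 0)) (M $$ (1, 1)) (M $$ (1, 2))
    (M $$ (2, 0)) (M $$ (2, 1)) (M $$ (2, 2))"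
  using assms by (intro eq_matI) (auto simp: less_3)

lemma vec3_eta:
  assumes "v \<in> carrier_vec 3"
  shows "v = vec3 (v $ 0) (v $ 1) (v $ 2)"
  using assms by (intro eq_vecI) (auto simp: less_3)

lemma mat3_eq_iff [simp]:
  "mat3 a b c d e f g h i = mat3 a' b' c' d' e' f' g' h' i' \<longleftrightarrow>
     a = a' \<and> b = b' \<and> c = c' \<and> d = d' \<and> e = e' \<and> f = f' \<and> g = g' \<and> h = h' \<and> i = i'"
  by (metis mat3_index)

lemma vec3_eq_iff [simp]: "vec3 x y z = vec3 x' y' z' \<longleftrightarrow> x = x' \<and> y = y' \<and> z = z'"
  by (metis vec3_index)

lemma mat3_mult [simp]:
  fixes a :: "'a :: semiring_0"
  shows "mat3 a b c d e f g h i * mat3 a' b' c' d' e' f' g' h' i' =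
    mat3 (a * a' + b * d' + c * g') (a * b' + b * e' + c * h') (a * c' + b * f' + c * i')
         (d * a' + e * d' + f * g') (d * b' + e * e' + f * h') (d * c' + e * f' + f * i')
         (g * a' + h * d' + i * g') (g * b' + h * e' + i * h') (g * c' + h * f' + i * i')"
  by (intro eq_matI) (auto simp: less_3 scalar_prod_def sum_3)

lemma mat3_mult_vec3 [simp]:
  fixes a :: "'a :: semiring_0"
  shows "mat3 a b c d e f g h i *\<^sub>v vec3 x y z =
    vec3 (a * x + b * y + c * z) (d * x + e * y + f * z) (g * x + h * y + i * z)"
  by (intro eq_vecI) (auto simp: less_3 scalar_prod_def sum_3)

lemma mat3_add [simp]:
  "mat3 a b c d e f g h i + mat3 a' b' c' d' e' f' g' h' i' =
    mat3 (a + a') (b + b') (c + c') (d + d') (e + e') (f + f') (g + g') (h + h') (i + i')"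
  by (intro eq_matI) (auto simp: less_3)

lemma smult_mat3 [simp]:
  "k \<cdot>\<^sub>m mat3 a b c d e f g h i =
    mat3 (k * a) (k * b) (k * c) (k * d) (k * e) (k * f) (k * g) (k * h) (k * i)"
  by (intro eq_matI) (auto simp: less_3)

lemma smult_vec3 [simp]: "k \<cdot>\<^sub>v vec3 x y z = vec3 (k * x) (k * y) (k * z)"
  by (intro eq_vecI) (auto simp: less_3)

lemma transpose_mat3 [simp]: "(mat3 a b c d e f g h i)\<^sup>T = mat3 a d g b e h c f i"
  by (intro eq_matI) (auto simp: less_3)

lemma one_mat3: "1\<^sub>m 3 = mat3 1 0 0 0 1 0 0 0 1"
  by (intro eq_matI) (auto simp: less_3)

lemma zero_mat3: "0\<^sub>m 3 3 = mat3 0 0 0 0 0 0 0 0 0"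
  by (intro eq_matI) (auto simp: less_3)

lemma zero_vec3: "0\<^sub>v 3 = vec3 0 0 0"
  by (intro eq_vecI) (auto simp: less_3)

section \<open>Equivalence of matrix spaces\<close>

lemma GL_iff: "P \<in> GL n \<longleftrightarrow> P \<in> carrier_mat n n \<and> (\<exists>P' \<in> carrier_mat n n. P * P' = 1\<^sub>m n \<and> P' * P = 1\<^sub>m n)"
proof
  assume P: "P \<in> GL n"
  then obtain P' where P': "P \<in> carrier_mat n n" "P * P' = 1\<^sub>m n" "P' * P = 1\<^sub>m (dim_row P')"
    unfolding GL_def invertible_mat_def inverts_mat_def by auto
  then have "P' \<in> carrier_mat n n"
    by (metis carrier_matD(2) carrier_matI index_mult_mat(2,3) index_one_mat(2,3))
  with P' show "P \<in> carrier_mat n n \<and> (\<exists>P' \<in> carrier_mat n n. P * P' = 1\<^sub>m n \<and> P' * P = 1\<^sub>m n)"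
    by auto
qed (auto simp: GL_def invertible_mat_def inverts_mat_def)

lemma one_GL: "1\<^sub>m n \<in> GL n"
  by (auto simp: GL_iff)

lemma GL_inverse:
  assumes "P \<in> GL n"
  obtains P' where "P' \<in> GL n" "P * P' = 1\<^sub>m n" "P' * P = 1\<^sub>m n"
  using assms by (auto simp: GL_iff)

lemma GL_mult:
  assumes "P \<in> GL n" "Q \<in> GL n"
  shows "P * Q \<in> GL n"
proof -
  obtain P' Q' where i: "P' \<in> GL n" "P * P' = 1\<^sub>m n" "P' * P = 1\<^sub>m n"
    "Q' \<in> GL n" "Q * Q' = 1\<^sub>m n" "Q' * Q = 1\<^sub>m n"
    by (metis GL_inverse assms)
  have [simp]: "P \<in> carrier_mat n n" "Q \<in> carrier_mat n n" "P' \<in> carrier_mat n n" "Q' \<in> carrier_mat n n"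
    using assms i by (auto simp: GL_iff)
  have "Q * (Q' * P') = P'" "P' * (P * Q) = Q"
    by (simp_all add: i left_mult_one_mat[of _ n n] flip: assoc_mult_mat[of _ n n _ n _ n])
  moreover have "P * Q * (Q' * P') = P * (Q * (Q' * P'))" "Q' * P' * (P * Q) = Q' * (P' * (P * Q))"
    by (rule assoc_mult_mat[of _ n n _ n _ n]; simp add: mult_carrier_mat[of _ n n])+
  ultimately have "P * Q * (Q' * P') = 1\<^sub>m n" "Q' * P' * (P * Q) = 1\<^sub>m n"
    by (simp_all add: i)
  then show ?thesis
    unfolding GL_iff by (intro conjI bexI[of _ "Q' * P'"]) (auto intro: mult_carrier_mat[of _ n n])
qed

lemma GL_transpose:
  assumes "P \<in> GL n"
  shows "P\<^sup>T \<in> GL n"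
proof -
  obtain P' where P': "P \<in> carrier_mat n n" "P' \<in> carrier_mat n n" "P * P' = 1\<^sub>m n" "P' * P = 1\<^sub>m n"
    using assms by (auto simp: GL_iff)
  then have "P\<^sup>T * P'\<^sup>T = 1\<^sub>m n" "P'\<^sup>T * P\<^sup>T = 1\<^sub>m n"
    by (simp_all flip: transpose_mult)
  with P' show ?thesis
    unfolding GL_iff by (intro conjI bexI[of _ "P'\<^sup>T"]) auto
qed

lemma mult_sandwich:
  fixes M :: "'a :: semiring_0 mat"
  assumes [simp]: "P' \<in> carrier_mat m\<^sub>0 m\<^sub>1" "P \<in> carrier_mat m\<^sub>1 m\<^sub>2" "M \<in> carrier_mat m\<^sub>2 m\<^sub>3"
    "Q \<in> carrier_mat m\<^sub>3 m\<^sub>4" "Q' \<in> carrier_mat m\<^sub>4 m\<^sub>5"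
  shows "P' * (P * M * Q) * Q' = (P' * P) * M * (Q * Q')"
proof -
  have 1: "P' * P * M * (Q * Q') = P' * P * M * Q * Q'"
    by (rule assoc_mult_mat[symmetric, of _ m\<^sub>0 m\<^sub>3 _ m\<^sub>4 _ m\<^sub>5])
      (use assms in \<open>auto intro!: mult_carrier_mat[of _ m\<^sub>0 m\<^sub>2] mult_carrier_mat[of P' m\<^sub>0 m\<^sub>1]\<close>)
  have 2: "P' * P * M = P' * (P * M)"
    by (rule assoc_mult_mat[of _ m\<^sub>0 m\<^sub>1 _ m\<^sub>2 _ m\<^sub>3]) auto
  have 3: "P' * (P * M) * Q = P' * (P * M * Q)"
    by (rule assoc_mult_mat[of _ m\<^sub>0 m\<^sub>1 _ m\<^sub>3 _ m\<^sub>4]) (use assms in \<open>auto intro: mult_carrier_mat[of _ m\<^sub>1 m\<^sub>2]\<close>)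
  show ?thesis
    by (subst 1) (simp only: 2 3)
qed

lemma mat_equivalentI:
  "P \<in> GL n \<Longrightarrow> Q \<in> GL p \<Longrightarrow> W = (\<lambda>M. P * M * Q) ` V \<Longrightarrow> mat_equivalent n p V W"
  unfolding mat_equivalent_def by (intro bexI)

lemma mat_equivalent_refl:
  assumes "V \<subseteq> carrier_mat n p"
  shows "mat_equivalent n p V V"
proof -
  have "1\<^sub>m n * M * 1\<^sub>m p = M" if "M \<in> V" for M
    using subsetD[OF assms that] by (simp add: left_mult_one_mat[of _ n p] right_mult_one_mat[of _ n p])
  then have "V = (\<lambda>M. 1\<^sub>m n * M * 1\<^sub>m p) ` V"
    by simp
  then show ?thesis
    by (rule mat_equivalentI[OF one_GL one_GL])
qed

lemma mat_equivalent_carrier: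
  assumes "mat_equivalent n p V W" "V \<subseteq> carrier_mat n p"
  shows "W \<subseteq> carrier_mat n p"
  using assms unfolding mat_equivalent_def GL_def by (auto simp: subset_iff)

lemma mat_equivalent_sym:
  assumes "mat_equivalent n p V W" "V \<subseteq> carrier_mat n p"
  shows "mat_equivalent n p W V"
proof -
  obtain P Q where PQ: "P \<in> GL n" "Q \<in> GL p" "W = (\<lambda>M. P * M * Q) ` V"
    using assms unfolding mat_equivalent_def by auto
  obtain P' Q' where i: "P' \<in> GL n" "P' * P = 1\<^sub>m n" "Q' \<in> GL p" "Q * Q' = 1\<^sub>m p"
    using PQ by (metis GL_inverse)
  have [simp]: "P \<in> carrier_mat n n" "Q \<in> carrier_mat p p" "P' \<in> carrier_mat n n" "Q' \<in> carrier_mat p p"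
    using PQ i by (auto simp: GL_iff)
  have "P' * (P * M * Q) * Q' = M" if "M \<in> V" for M
  proof -
    have [simp]: "M \<in> carrier_mat n p"
      using that assms by auto
    have "P' * (P * M * Q) * Q' = (P' * P) * M * (Q * Q')"
      by (rule mult_sandwich[of _ n n _ n _ p _ p _ p]) auto
    then show ?thesis
      by (simp add: i left_mult_one_mat[of _ n p] right_mult_one_mat[of _ n p])
  qed
  then have "V = (\<lambda>M. P' * M * Q') ` W"
    by (simp add: PQ(3) image_image)
  then show ?thesis
    by (rule mat_equivalentI[OF i(1,3)])
qed

lemma mat_equivalent_trans:
  assumes "mat_equivalent n p U V" "mat_equivalent n p V W" "U \<subseteq> carrier_mat n p"
  shows "mat_equivalent n p U W"
proof -
  obtain P Q where PQ: "P \<in> GL n" "Q \<in> GL p" "V = (\<lambda>M. P * M * Q) ` U"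
    using assms unfolding mat_equivalent_def by auto
  obtain P' Q' where PQ': "P' \<in> GL n" "Q' \<in> GL p" "W = (\<lambda>M. P' * M * Q') ` V"
    using assms unfolding mat_equivalent_def by auto
  have [simp]: "P \<in> carrier_mat n n" "Q \<in> carrier_mat p p" "P' \<in> carrier_mat n n" "Q' \<in> carrier_mat p p"
    using PQ PQ' by (auto simp: GL_iff)
  have "P' * (P * M * Q) * Q' = P' * P * M * (Q * Q')" if "M \<in> U" for M
  proof -
    have [simp]: "M \<in> carrier_mat n p"
      using that assms by auto
    show ?thesis
      by (rule mult_sandwich[of _ n n _ n _ p _ p _ p]) auto
  qed
  then have "W = (\<lambda>M. P' * P * M * (Q * Q')) ` U"
    by (simp add: PQ(3) PQ'(3) image_image)
  then show ?thesis
    by (rule mat_equivalentI[OF GL_mult[OF PQ'(1) PQ(1)] GL_mult[OF PQ(2) PQ'(2)]])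
qed

lemma mat_equivalent_transpose:
  assumes "mat_equivalent n p V W" "V \<subseteq> carrier_mat n p"
  shows "mat_equivalent p n (transpose_mat ` V) (transpose_mat ` W)"
proof -
  obtain P Q where PQ: "P \<in> GL n" "Q \<in> GL p" "W = (\<lambda>M. P * M * Q) ` V"
    using assms unfolding mat_equivalent_def by auto
  have [simp]: "P \<in> carrier_mat n n" "Q \<in> carrier_mat p p"
    using PQ by (auto simp: GL_iff)
  have "(P * M * Q)\<^sup>T = Q\<^sup>T * M\<^sup>T * P\<^sup>T" if "M \<in> V" for M
  proof -
    have [simp]: "M \<in> carrier_mat n p"
      using that assms by auto
    have "(P * M * Q)\<^sup>T = Q\<^sup>T * (M\<^sup>T * P\<^sup>T)"
      by (simp add: transpose_mult[of _ n p _ p] transpose_mult[of _ n n _ p] mult_carrier_mat[of _ n n _ p])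
    also have "\<dots> = Q\<^sup>T * M\<^sup>T * P\<^sup>T"
      by (rule assoc_mult_mat[symmetric, of _ p p _ n _ n]) auto
    finally show ?thesis .
  qed
  then have "transpose_mat ` W = (\<lambda>M. Q\<^sup>T * M * P\<^sup>T) ` (transpose_mat ` V)"
    by (simp add: PQ(3) image_image)
  then show ?thesis
    by (rule mat_equivalentI[OF GL_transpose[OF PQ(2)] GL_transpose[OF PQ(1)]])
qed

section \<open>Vectors whose images lie on a line\<close>

text \<open>The vectors \<open>x\<close> such that \<open>V x = {M x | M \<in> V}\<close> lies on a line. The line is given by a spanning vector
  \<open>w\<close>; the choice \<open>w = 0\<close> accounts for \<open>V x = 0\<close>.\<close>

definition thin :: "nat \<Rightarrow> nat \<Rightarrow> 'a :: field mat set \<Rightarrow> 'a vec set" where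
  "thin n p V = {x \<in> carrier_vec p. \<exists>w \<in> carrier_vec n. \<forall>M \<in> V. \<exists>k. M *\<^sub>v x = k \<cdot>\<^sub>v w}"

lemma thin_image:
  assumes "P \<in> carrier_mat n n" "Q \<in> carrier_mat p p" "V \<subseteq> carrier_mat n p"
    and x: "x \<in> carrier_vec p" "Q *\<^sub>v x \<in> thin n p V"
  shows "x \<in> thin n p ((\<lambda>M. P * M * Q) ` V)"
proof -
  obtain w where w: "w \<in> carrier_vec n" "\<forall>M \<in> V. \<exists>k. M *\<^sub>v (Q *\<^sub>v x) = k \<cdot>\<^sub>v w"
    using x by (auto simp: thin_def)
  have "\<exists>k. P * M * Q *\<^sub>v x = k \<cdot>\<^sub>v (P *\<^sub>v w)" if M: "M \<in> V" for M
  proof -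
    obtain k where "M *\<^sub>v (Q *\<^sub>v x) = k \<cdot>\<^sub>v w"
      using w M by auto
    moreover have "P * M * Q *\<^sub>v x = P *\<^sub>v (M *\<^sub>v (Q *\<^sub>v x))"
      using assms M by (auto simp: subset_iff assoc_mult_mat_vec[of _ n p _ p] assoc_mult_mat_vec[of _ n n _ p])
    ultimately show ?thesis
      using assms(1) w(1) by (auto simp: mult_mat_vec)
  qed
  moreover have "P *\<^sub>v w \<in> carrier_vec n"
    using assms(1) w(1) by auto
  ultimately show ?thesis
    using x(1) by (force simp: thin_def)
qed

text \<open>For \<open>W = P V Q\<close> one has \<open>W x = P (V (Q x))\<close>, so the inverse of \<open>Q\<close> maps the thin vectors of \<open>V\<close>
  injectively to those of \<open>W\<close>.\<close>

lemma card_thin_equivalent_le: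
  assumes e: "mat_equivalent n p V W" and V: "V \<subseteq> carrier_mat n p"
    and fin: "finite (carrier_vec p :: 'a :: field vec set)"
  shows "card (thin n p V) \<le> card (thin n p (W :: 'a mat set))"
proof -
  obtain P Q where PQ: "P \<in> GL n" "Q \<in> GL p" "W = (\<lambda>M. P * M * Q) ` V"
    using e unfolding mat_equivalent_def by auto
  obtain Q' where Q': "Q' \<in> GL p" "Q * Q' = 1\<^sub>m p"
    using PQ by (metis GL_inverse)
  have c [simp]: "P \<in> carrier_mat n n" "Q \<in> carrier_mat p p" "Q' \<in> carrier_mat p p"
    using PQ Q' by (auto simp: GL_iff)
  have QQ': "Q *\<^sub>v (Q' *\<^sub>v x) = x" if "x \<in> carrier_vec p" for x
    using that Q' by (simp flip: assoc_mult_mat_vec[of _ p p _ p])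
  have sub: "thin n p V \<subseteq> carrier_vec p" "thin n p W \<subseteq> carrier_vec p"
    by (auto simp: thin_def)
  have "inj_on (\<lambda>x. Q' *\<^sub>v x) (thin n p V)"
    using sub by (metis (no_types, lifting) QQ' inj_onI subsetD)
  moreover have "(\<lambda>x. Q' *\<^sub>v x) ` thin n p V \<subseteq> thin n p W"
  proof clarify
    fix x assume x: "x \<in> thin n p V"
    then have "x \<in> carrier_vec p"
      using sub by auto
    with x show "Q' *\<^sub>v x \<in> thin n p W"
      unfolding PQ(3) by (intro thin_image[OF c(1,2) V]) (auto simp: QQ' intro: mult_mat_vec_carrier[OF c(3)])
  qed
  moreover have "finite (thin n p W)"
    using sub fin finite_subset by blast
  ultimately show ?thesis
    by (rule card_inj_on_le)
qed

lemma card_thin_equivalent: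
  assumes e: "mat_equivalent n p V W" and V: "V \<subseteq> carrier_mat n p"
    and fin: "finite (carrier_vec p :: 'a :: field vec set)"
  shows "card (thin n p V) = card (thin n p (W :: 'a mat set))"
  using card_thin_equivalent_le[OF e V fin]
    card_thin_equivalent_le[OF mat_equivalent_sym[OF e V] mat_equivalent_carrier[OF e V] fin] by simp

section \<open>Dimension and cardinality over the two-element field\<close>

text \<open>Coordinates with respect to a basis \<open>B\<close> identify the space with the functions from \<open>B\<close> to the field.\<close>

lemma (in vectorspace) card_carrier_eq_power_dim:
  assumes "finite (carrier V)"
  shows "card (carrier V) = card (carrier K) ^ dim"
proof -
  have "fin_dim"
    unfolding fin_dim_def using assms
    by (intro exI[of _ "carrier V"]) (auto intro: span_closed in_own_span[THEN subsetD] simp: span_is_subset2 in_own_span)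
  then obtain B where B: "finite B" "basis B"
    using finite_basis_exists by auto
  then have BV: "B \<subseteq> carrier V"
    by (simp add: basis_def)
  have u: "\<exists>!a. a \<in> B \<rightarrow>\<^sub>E carrier K \<and> lincomb a B = v" if "v \<in> carrier V" for v
    using basis_criterion[OF B(1) BV] B(2) that by blast
  have c: "lincomb a B \<in> carrier V" if "a \<in> B \<rightarrow>\<^sub>E carrier K" for a
    using that BV by (intro lincomb_closed) auto
  have "bij_betw (\<lambda>a. lincomb a B) (B \<rightarrow>\<^sub>E carrier K) (carrier V)"
    unfolding bij_betw_def inj_on_def
  proof (intro conjI ballI impI)
    show "a = a'" if "a \<in> B \<rightarrow>\<^sub>E carrier K" "a' \<in> B \<rightarrow>\<^sub>E carrier K" "lincomb a B = lincomb a' B" for a a'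
      using u[OF c[OF that(1)]] that by metis
    show "(\<lambda>a. lincomb a B) ` (B \<rightarrow>\<^sub>E carrier K) = carrier V"
      using u c by blast
  qed
  then have "card (carrier V) = card (B \<rightarrow>\<^sub>E carrier K)"
    by (simp add: bij_betw_same_card)
  also have "\<dots> = card (carrier K) ^ dim"
    using B by (simp add: card_PiE dim_basis)
  finally show ?thesis .
qed

lemma mat_subspaceD:
  assumes "mat_subspace n p (V :: 'a :: field mat set)"
  shows "V \<subseteq> carrier_mat n p" "0\<^sub>m n p \<in> V" "A \<in> V \<Longrightarrow> B \<in> V \<Longrightarrow> A + B \<in> V" "A \<in> V \<Longrightarrow> k \<cdot>\<^sub>m A \<in> V"
proof -
  interpret vectorspace class_ring "module_mat TYPE('a) n p"
    by (rule matrix_vs)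
  have s: "submodule class_ring V (module_mat TYPE('a) n p)"
    using assms by (simp add: mat_subspace_def)
  show "V \<subseteq> carrier_mat n p" "0\<^sub>m n p \<in> V" "A \<in> V \<Longrightarrow> B \<in> V \<Longrightarrow> A + B \<in> V" "A \<in> V \<Longrightarrow> k \<cdot>\<^sub>m A \<in> V"
    using submodule.subset[OF s] submodule.zero_closed[OF s] submodule.m_closed[OF s] submodule.smult_closed[OF s]
    by (auto simp: matrix_vs_simps)
qed

lemma card_mat_subspace:
  assumes "mat_subspace n p (V :: bit mat set)" "finite V"
  shows "card V = 2 ^ mat_space_dim n p V"
proof -
  interpret vectorspace class_ring "module_mat TYPE(bit) n p"
    by (rule matrix_vs)
  have "vectorspace class_ring ((module_mat TYPE(bit) n p)\<lparr>carrier := V\<rparr>)"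
    using assms(1) by (simp only: mat_subspace_def subspace_is_vs)
  from vectorspace.card_carrier_eq_power_dim[OF this] assms(2) show ?thesis
    unfolding mat_space_dim_def by (simp add: class_ring_simps bit_card)
qed

section \<open>Reduction of upper triangular families\<close>

text \<open>
  Sums and products of bits are kept as ring operations rather than Boolean connectives: the
  identities below are polynomial identities in characteristic 2, and follow by ring normalisation
  together with the cancellation \<open>x + x = 0\<close>.
\<close>

declare add_bit_eq_xor [simp del] mult_bit_eq_and [simp del]

lemma bit_add_self: "x + x = (0 :: bit)" "x + (x + y) = (y :: bit)"
  by (cases x; simp)+

lemma finite_carrier_vec3_bit: "finite (carrier_vec 3 :: bit vec set)"
proof (rule finite_subset)
  show "carrier_vec 3 \<subseteq> (\<lambda>(x, y, z). vec3 x y z) ` (UNIV :: (bit \<times> bit \<times> bit) set)"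
  proof
    fix v :: "bit vec" assume "v \<in> carrier_vec 3"
    from vec3_eta[OF this] show "v \<in> (\<lambda>(x, y, z). vec3 x y z) ` UNIV"
      by (intro image_eqI[where x = "(v $ 0, v $ 1, v $ 2)"]) simp_all
  qed
  show "finite ((\<lambda>(x, y, z). vec3 x y z) ` (UNIV :: (bit \<times> bit \<times> bit) set))"
    by (simp add: finite_prod bit_finite)
qed

lemma J3_iff: "M \<in> J3 \<longleftrightarrow> (\<exists>a b x y z. M = mat3 a x y 0 (a + b) z 0 0 b)"
proof
  assume "M \<in> J3"
  then have M: "M \<in> carrier_mat 3 3" "upper_triangular M" "M $$ (0, 0) + M $$ (1, 1) + M $$ (2, 2) = 0"
    by (auto simp: J3_def sum_3)
  have z: "M $$ (1, 0) = 0" "M $$ (2, 0) = 0" "M $$ (2, 1) = 0"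
    using M(1) by (auto intro!: upper_triangularD[OF M(2)])
  have "M $$ (1, 1) = M $$ (0, 0) + M $$ (2, 2)"
    using M(3) by (cases "M $$ (0, 0)"; cases "M $$ (1, 1)"; cases "M $$ (2, 2)"; simp)
  with mat3_eta[OF M(1)] z show "\<exists>a b x y z. M = mat3 a x y 0 (a + b) z 0 0 b"
    by metis
next
  assume "\<exists>a b x y z. M = mat3 a x y 0 (a + b) z 0 0 b"
  then show "M \<in> J3"
    by (auto simp: J3_def sum_3 upper_triangular_def less_3 less_2_cases_iff add_ac bit_add_self)
qed

lemma J3E:
  assumes "M \<in> J3"
  obtains a b x y z where "M = mat3 a x y 0 (a + b) z 0 0 b"
  using assms unfolding J3_iff by blast

lemma finite_J3: "finite J3"
proof (rule finite_subset)
  show "J3 \<subseteq> (\<lambda>(a, b, x, y, z). mat3 a x y 0 (a + b) z 0 0 b) ` UNIV"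
  proof
    fix M assume "M \<in> J3"
    then obtain a b x y z where "M = mat3 a x y 0 (a + b) z 0 0 b"
      by (auto simp: J3_iff)
    then show "M \<in> (\<lambda>(a, b, x, y, z). mat3 a x y 0 (a + b) z 0 0 b) ` UNIV"
      by (intro image_eqI[where x = "(a, b, x, y, z)"]) simp_all
  qed
qed (simp add: finite_prod bit_finite)

text \<open>Position \<open>(1,2)\<close> carries the form \<open>l1 a + l2 b\<close>, position \<open>(1,3)\<close> the form \<open>k1 a + k2 b\<close>, position
  \<open>(2,3)\<close> the form \<open>m1 a + m2 b\<close>, and \<open>(n1, n2, n3)\<close> are the entries at these positions of the strictly
  upper triangular matrix \<open>N\<close> that \<open>c\<close> multiplies.\<close>

definition upper_family :: "bit \<Rightarrow> bit \<Rightarrow> bit \<Rightarrow> bit \<Rightarrow> bit \<Rightarrow> bit \<Rightarrow> bit \<Rightarrow> bit \<Rightarrow> bit \<Rightarrow> bit \<Rightarrow> bit \<Rightarrow> bit \<Rightarrow> bit mat" where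
  "upper_family l1 l2 k1 k2 m1 m2 n1 n2 n3 a b c =
     mat3 a (l1 * a + l2 * b + n1 * c) (k1 * a + k2 * b + n2 * c)
          0 (a + b) (m1 * a + m2 * b + n3 * c)
          0 0 b"

lemma associated_space_equivalentI:
  assumes "P \<in> GL 3" "Q \<in> GL 3"
    and "\<And>a b c. \<exists>a' b' c'. P * G a b c * Q = G' a' b' c'"
    and "\<And>a b c. \<exists>a' b' c'. P * G a' b' c' * Q = G' a b c"
  shows "mat_equivalent 3 3 (associated_space G) (associated_space G')"
proof -
  have "associated_space G' = (\<lambda>M. P * M * Q) ` associated_space G"
  proof (intro equalityI subsetI)
    fix N assume "N \<in> associated_space G'"
    then obtain a b c where "N = G' a b c"
      by (auto simp: associated_space_def)
    then obtain a' b' c' where "N = P * G a' b' c' * Q"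
      using assms(4) by metis
    then show "N \<in> (\<lambda>M. P * M * Q) ` associated_space G"
      by (auto simp: associated_space_def)
  next
    fix N assume "N \<in> (\<lambda>M. P * M * Q) ` associated_space G"
    then obtain a b c where "N = P * G a b c * Q"
      by (auto simp: associated_space_def)
    then obtain a' b' c' where "N = G' a' b' c'"
      using assms(3) by metis
    then show "N \<in> associated_space G'"
      by (auto simp: associated_space_def)
  qed
  then show ?thesis
    by (rule mat_equivalentI[OF assms(1,2)])
qed

lemma unitriangular_GL: "mat3 1 x y 0 1 z 0 0 1 \<in> GL 3" for x :: "'a :: field"
  unfolding GL_iff
  by (intro conjI bexI[of _ "mat3 1 (- x) (x * z - y) 0 1 (- z) 0 0 1"]) (auto simp: one_mat3)

lemma involution_GL:
  assumes "P \<in> carrier_mat n n" "P * P = 1\<^sub>m n"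
  shows "P \<in> GL n"
  using assms by (auto simp: GL_iff)

text \<open>Adding \<open>l2\<close> times row 2 to row 1 and \<open>l1 + l2\<close> times column 1 to column 2 adds
  \<open>l2 (a + b) + (l1 + l2) a = l1 a + l2 b\<close> to position \<open>(1,2)\<close>; position \<open>(2,3)\<close> is treated in the same
  way with \<open>m1 + m2\<close> times row 3 and \<open>m1\<close> times column 2. These operations also carry \<open>l2 n3 c\<close> and
  \<open>m1 n1 c\<close> into the corner, which alters \<open>n2\<close>, as well as multiples of \<open>a\<close> and \<open>b\<close>, which are removed
  together with \<open>k1 a + k2 b\<close> by adding multiples of row 3 to row 1 and of column 1 to column 3.\<close>

lemma upper_family_equivalent_diagonal:
  "mat_equivalent 3 3 (associated_space (upper_family l1 l2 k1 k2 m1 m2 n1 n2 n3))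
     (associated_space (upper_family 0 0 0 0 0 0 n1 (n2 + l2 * n3 + m1 * n1) n3))"
proof -
  \<comment> \<open>The total coefficients of \<open>b\<close> and of \<open>a\<close> in the corner after the other operations.\<close>
  define p q where "p = k2 + l2 * m2 + m1 * (l2 + l2)" and "q = k1 + l2 * m1 + m1 * (l1 + l2)"
  show ?thesis
  proof (rule associated_space_equivalentI)
    fix a b c
    have "mat3 1 l2 p 0 1 (m1 + m2) 0 0 1 * upper_family l1 l2 k1 k2 m1 m2 n1 n2 n3 a b c * mat3 1 (l1 + l2) q 0 1 m1 0 0 1 =
      upper_family 0 0 0 0 0 0 n1 (n2 + l2 * n3 + m1 * n1) n3 a b c"
      by (simp add: upper_family_def p_def q_def algebra_simps bit_add_self)
    then show "\<exists>a' b' c'. mat3 1 l2 p 0 1 (m1 + m2) 0 0 1 * upper_family l1 l2 k1 k2 m1 m2 n1 n2 n3 a b c * mat3 1 (l1 + l2) q 0 1 m1 0 0 1 =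
      upper_family 0 0 0 0 0 0 n1 (n2 + l2 * n3 + m1 * n1) n3 a' b' c'"
      "\<exists>a' b' c'. mat3 1 l2 p 0 1 (m1 + m2) 0 0 1 * upper_family l1 l2 k1 k2 m1 m2 n1 n2 n3 a' b' c' * mat3 1 (l1 + l2) q 0 1 m1 0 0 1 =
      upper_family 0 0 0 0 0 0 n1 (n2 + l2 * n3 + m1 * n1) n3 a b c"
      by blast+
  qed (rule unitriangular_GL)+
qed

lemma M_entries:
  "M1 a b c = mat3 a 0 c 0 (a + b) 0 0 0 b"
  "M2 a b c = mat3 a c 0 0 (a + b) a 0 0 b"
  "M3 a b c = mat3 a b 0 0 (a + b) c 0 0 b"
  "M4 a b c = mat3 a c 0 0 (a + b) c 0 0 b"
  by (simp_all add: M1_def M2_def M3_def M4_def mat3_def)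

lemma associated_space_cong:
  assumes "\<And>a b c. G a b c = G' a b (c + k a b)"
  shows "associated_space (G :: bit \<Rightarrow> bit \<Rightarrow> bit \<Rightarrow> bit mat) = associated_space G'"
proof -
  have "G' a b c = G a b (c + k a b)" for a b c
    by (simp add: assms add.assoc bit_add_self)
  then show ?thesis
    unfolding associated_space_def using assms by (auto, metis+)
qed

text \<open>\<open>M4\<close> appears twice because replacing \<open>c\<close> by \<open>c + b\<close> gives a second parametrisation of the same space;
  its reduction to diagonal form has a different corner entry.\<close>

lemma M_eq_upper_family:
  "associated_space M1 = associated_space (upper_family 0 0 0 0 0 0 0 1 0)"
  "associated_space M2 = associated_space (upper_family 0 0 0 0 1 0 1 0 0)"
  "associated_space M3 = associated_space (upper_family 0 1 0 0 0 0 0 0 1)"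
  "associated_space M4 = associated_space (upper_family 0 0 0 0 0 0 1 0 1)"
  "associated_space M4 = associated_space (upper_family 0 1 0 0 0 1 1 0 1)"
proof -
  show "associated_space M4 = associated_space (upper_family 0 1 0 0 0 1 1 0 1)"
    by (rule associated_space_cong[where k = "\<lambda>a b. b"]) (simp add: M_entries upper_family_def add_ac bit_add_self)
qed (rule associated_space_cong[where k = "\<lambda>a b. 0"]; simp add: M_entries upper_family_def)+

lemma associated_space_carrier:
  "associated_space M1 \<subseteq> carrier_mat 3 3" "associated_space M2 \<subseteq> carrier_mat 3 3"
  "associated_space M3 \<subseteq> carrier_mat 3 3" "associated_space M4 \<subseteq> carrier_mat 3 3"
  "associated_space (upper_family l1 l2 k1 k2 m1 m2 n1 n2 n3) \<subseteq> carrier_mat 3 3"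
  by (auto simp: associated_space_def M_entries upper_family_def)

lemma swap_GL: "mat3 0 1 0 1 0 0 0 0 1 \<in> GL 3" "mat3 1 0 0 0 0 1 0 1 0 \<in> GL 3"
  by (rule involution_GL; simp add: one_mat3)+

text \<open>Exchanging the last two rows and columns moves the diagonal to \<open>(a, b, a + b)\<close>, and \<open>b := a + b\<close> restores
  it. The lemma below does the same with the first two rows and columns.\<close>

lemma diagonal_100_equivalent_M1: "mat_equivalent 3 3 (associated_space (upper_family 0 0 0 0 0 0 1 0 0)) (associated_space M1)"
proof (rule associated_space_equivalentI[OF swap_GL(2) swap_GL(2)])
  let ?P = "mat3 1 0 0 0 0 1 0 1 0 :: bit mat"
  have "?P * upper_family 0 0 0 0 0 0 1 0 0 a b c * ?P = M1 a (a + b) c" for a b c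
    by (simp add: upper_family_def M_entries bit_add_self)
  then show "\<exists>a' b' c'. ?P * upper_family 0 0 0 0 0 0 1 0 0 a b c * ?P = M1 a' b' c'"
    "\<exists>a' b' c'. ?P * upper_family 0 0 0 0 0 0 1 0 0 a' b' c' * ?P = M1 a b c" for a b c
    by (metis bit_add_self(2))+
qed

lemma diagonal_001_equivalent_M1: "mat_equivalent 3 3 (associated_space (upper_family 0 0 0 0 0 0 0 0 1)) (associated_space M1)"
proof (rule associated_space_equivalentI[OF swap_GL(1) swap_GL(1)])
  let ?P = "mat3 0 1 0 1 0 0 0 0 1 :: bit mat"
  have "?P * upper_family 0 0 0 0 0 0 0 0 1 a b c * ?P = M1 (a + b) b c" for a b c
    by (simp add: upper_family_def M_entries add_ac bit_add_self)
  then show "\<exists>a' b' c'. ?P * upper_family 0 0 0 0 0 0 0 0 1 a b c * ?P = M1 a' b' c'"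
    "\<exists>a' b' c'. ?P * upper_family 0 0 0 0 0 0 0 0 1 a' b' c' * ?P = M1 a b c" for a b c
    by (metis bit_add_self add.commute)+
qed

lemma ex_less_4: "(\<exists>k < 4. P k) \<longleftrightarrow> P 0 \<or> P 1 \<or> P 2 \<or> P (3 :: nat)"
proof -
  have "k < 4 \<longleftrightarrow> k = 0 \<or> k = 1 \<or> k = 2 \<or> k = (3 :: nat)" for k
    by auto
  then show ?thesis
    by auto
qed

text \<open>The cases \<open>N = (1,1,0), (0,1,1), (1,1,1)\<close> are obtained backwards, by reducing \<open>M2\<close>, \<open>M3\<close> and the
  second form of \<open>M4\<close>.\<close>

lemma diagonal_equivalent_M:
  assumes "(n1, n2, n3) \<noteq> (0, 0, 0)"
  shows "\<exists>k < 4. mat_equivalent 3 3 (associated_space (upper_family 0 0 0 0 0 0 n1 n2 n3))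
    (associated_space ([M1, M2, M3, M4] ! k))"
proof -
  let ?e = "\<lambda>n1 n2 n3 M. mat_equivalent 3 3 (associated_space (upper_family 0 0 0 0 0 0 n1 n2 n3)) (associated_space M)"
  note s = mat_equivalent_sym[OF _ associated_space_carrier(5)] and r = mat_equivalent_refl[OF associated_space_carrier(5)]
  have "?e 0 1 0 M1" "?e 1 0 1 M4"
    by (simp_all only: M_eq_upper_family(1,4) r)
  moreover have "?e 1 1 0 M2"
    using s[OF upper_family_equivalent_diagonal[of 0 0 0 0 1 0 1 0 0]] by (simp add: M_eq_upper_family)
  moreover have "?e 0 1 1 M3"
    using s[OF upper_family_equivalent_diagonal[of 0 1 0 0 0 0 0 0 1]] by (simp add: M_eq_upper_family)
  moreover have "?e 1 1 1 M4"
    using s[OF upper_family_equivalent_diagonal[of 0 1 0 0 0 1 1 0 1]] by (simp add: M_eq_upper_family(5))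
  ultimately show ?thesis
    using assms diagonal_100_equivalent_M1 diagonal_001_equivalent_M1 by (cases n1; cases n2; cases n3; simp add: ex_less_4)
qed

section \<open>The four spaces are pairwise inequivalent\<close>

lemma card_thin_associated_space:
  assumes "\<And>x y z. (x, y, z) \<in> T \<longleftrightarrow>
    (\<exists>w1 w2 w3. \<forall>a b c. \<exists>k. G a b c *\<^sub>v vec3 x y z = k \<cdot>\<^sub>v vec3 w1 w2 (w3 :: bit))"
  shows "card (thin 3 3 (associated_space G)) = card T"
proof -
  have "v \<in> thin 3 3 (associated_space G) \<longleftrightarrow> v \<in> (\<lambda>(x, y, z). vec3 x y z) ` T" for v
  proof (cases "v \<in> carrier_vec 3")
    case True
    then obtain x y z where v: "v = vec3 x y z"
      using vec3_eta by blast
    have "v \<in> thin 3 3 (associated_space G) \<longleftrightarrow>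
       (\<exists>w \<in> carrier_vec 3. \<forall>a b c. \<exists>k. G a b c *\<^sub>v vec3 x y z = k \<cdot>\<^sub>v w)"
      by (auto simp: thin_def v associated_space_def) metis+
    also have "\<dots> \<longleftrightarrow> (\<exists>w1 w2 w3. \<forall>a b c. \<exists>k. G a b c *\<^sub>v vec3 x y z = k \<cdot>\<^sub>v vec3 w1 w2 w3)"
      using vec3_eta vec3_carrier by metis
    also have "\<dots> \<longleftrightarrow> v \<in> (\<lambda>(x, y, z). vec3 x y z) ` T"
      unfolding assms[symmetric] v by force
    finally show ?thesis .
  qed (auto simp: thin_def)
  then have "thin 3 3 (associated_space G) = (\<lambda>(x, y, z). vec3 x y z) ` T"
    by blast
  then show ?thesis
    by (simp add: card_image inj_on_def split_def prod_eq_iff)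
qed

lemma transpose_associated_space:
  "transpose_mat ` associated_space G = associated_space (\<lambda>a b c. (G a b c)\<^sup>T)"
  unfolding associated_space_def by blast

lemma card_thin_M:
  "card (thin 3 3 (associated_space M1)) = 3"
  "card (thin 3 3 (associated_space M2)) = 2"
  "card (thin 3 3 (associated_space M3)) = 3"
  "card (thin 3 3 (associated_space M4)) = 2"
proof -
  have "(x, y, z) \<in> {(0, 0, 0), (1, 0, 0), (0, 1, 0)} \<longleftrightarrow>
    (\<exists>w1 w2 w3. \<forall>a b c. \<exists>k. M1 a b c *\<^sub>v vec3 x y z = k \<cdot>\<^sub>v vec3 w1 w2 (w3 :: bit))" for x y z
    by (cases x; cases y; cases z; simp add: M_entries ex_bit all_bit)
  from card_thin_associated_space[OF this] show "card (thin 3 3 (associated_space M1)) = 3"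
    by (simp add: transpose_associated_space)
  have "(x, y, z) \<in> {(0, 0, 0), (1, 0, 0)} \<longleftrightarrow>
    (\<exists>w1 w2 w3. \<forall>a b c. \<exists>k. M2 a b c *\<^sub>v vec3 x y z = k \<cdot>\<^sub>v vec3 w1 w2 (w3 :: bit))" for x y z
    by (cases x; cases y; cases z; simp add: M_entries ex_bit all_bit)
  from card_thin_associated_space[OF this] show "card (thin 3 3 (associated_space M2)) = 2"
    by (simp add: transpose_associated_space)
  have "(x, y, z) \<in> {(0, 0, 0), (1, 0, 0), (1, 1, 0)} \<longleftrightarrow>
    (\<exists>w1 w2 w3. \<forall>a b c. \<exists>k. M3 a b c *\<^sub>v vec3 x y z = k \<cdot>\<^sub>v vec3 w1 w2 (w3 :: bit))" for x y z
    by (cases x; cases y; cases z; simp add: M_entries ex_bit all_bit)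
  from card_thin_associated_space[OF this] show "card (thin 3 3 (associated_space M3)) = 3"
    by (simp add: transpose_associated_space)
  have "(x, y, z) \<in> {(0, 0, 0), (1, 0, 0)} \<longleftrightarrow>
    (\<exists>w1 w2 w3. \<forall>a b c. \<exists>k. M4 a b c *\<^sub>v vec3 x y z = k \<cdot>\<^sub>v vec3 w1 w2 (w3 :: bit))" for x y z
    by (cases x; cases y; cases z; simp add: M_entries ex_bit all_bit)
  from card_thin_associated_space[OF this] show "card (thin 3 3 (associated_space M4)) = 2"
    by (simp add: transpose_associated_space)
qed

lemma card_thin_transpose_M:
  "card (thin 3 3 (transpose_mat ` associated_space M1)) = 3"
  "card (thin 3 3 (transpose_mat ` associated_space M2)) = 3"
  "card (thin 3 3 (transpose_mat ` associated_space M3)) = 2"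
  "card (thin 3 3 (transpose_mat ` associated_space M4)) = 2"
proof -
  have "(x, y, z) \<in> {(0, 0, 0), (0, 1, 0), (0, 0, 1)} \<longleftrightarrow>
    (\<exists>w1 w2 w3. \<forall>a b c. \<exists>k. (M1 a b c)\<^sup>T *\<^sub>v vec3 x y z = k \<cdot>\<^sub>v vec3 w1 w2 (w3 :: bit))" for x y z
    by (cases x; cases y; cases z; simp add: M_entries ex_bit all_bit)
  from card_thin_associated_space[OF this] show "card (thin 3 3 (transpose_mat ` associated_space M1)) = 3"
    by (simp add: transpose_associated_space)
  have "(x, y, z) \<in> {(0, 0, 0), (0, 0, 1), (0, 1, 1)} \<longleftrightarrow>
    (\<exists>w1 w2 w3. \<forall>a b c. \<exists>k. (M2 a b c)\<^sup>T *\<^sub>v vec3 x y z = k \<cdot>\<^sub>v vec3 w1 w2 (w3 :: bit))" for x y z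
    by (cases x; cases y; cases z; simp add: M_entries ex_bit all_bit)
  from card_thin_associated_space[OF this] show "card (thin 3 3 (transpose_mat ` associated_space M2)) = 3"
    by (simp add: transpose_associated_space)
  have "(x, y, z) \<in> {(0, 0, 0), (0, 0, 1)} \<longleftrightarrow>
    (\<exists>w1 w2 w3. \<forall>a b c. \<exists>k. (M3 a b c)\<^sup>T *\<^sub>v vec3 x y z = k \<cdot>\<^sub>v vec3 w1 w2 (w3 :: bit))" for x y z
    by (cases x; cases y; cases z; simp add: M_entries ex_bit all_bit)
  from card_thin_associated_space[OF this] show "card (thin 3 3 (transpose_mat ` associated_space M3)) = 2"
    by (simp add: transpose_associated_space)
  have "(x, y, z) \<in> {(0, 0, 0), (0, 0, 1)} \<longleftrightarrow>
    (\<exists>w1 w2 w3. \<forall>a b c. \<exists>k. (M4 a b c)\<^sup>T *\<^sub>v vec3 x y z = k \<cdot>\<^sub>v vec3 w1 w2 (w3 :: bit))" for x y z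
    by (cases x; cases y; cases z; simp add: M_entries ex_bit all_bit)
  from card_thin_associated_space[OF this] show "card (thin 3 3 (transpose_mat ` associated_space M4)) = 2"
    by (simp add: transpose_associated_space)
qed

text \<open>The two counts distinguish the spaces: the first separates \<open>M1\<close> and \<open>M3\<close> from \<open>M2\<close> and \<open>M4\<close>, the second
  \<open>M1\<close> and \<open>M2\<close> from \<open>M3\<close> and \<open>M4\<close>.\<close>

lemma M_inequivalent:
  assumes "i < 4" "j < 4"
    and "mat_equivalent 3 3 (associated_space ([M1, M2, M3, M4] ! i)) (associated_space ([M1, M2, M3, M4] ! j))"
  shows "i = j"
proof -
  let ?S = "\<lambda>k. associated_space ([M1, M2, M3, M4] ! k)"
  have k: "k = 0 \<or> k = 1 \<or> k = 2 \<or> k = 3" if "k < 4" for k :: nat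
    using that by auto
  have c: "?S i \<subseteq> carrier_mat 3 3"
    using k[OF assms(1)] associated_space_carrier by auto
  then have c': "transpose_mat ` ?S i \<subseteq> carrier_mat 3 3"
    by auto
  have "card (thin 3 3 (?S i)) = card (thin 3 3 (?S j))"
    by (rule card_thin_equivalent[OF assms(3) c finite_carrier_vec3_bit])
  moreover have "card (thin 3 3 (transpose_mat ` ?S i)) = card (thin 3 3 (transpose_mat ` ?S j))"
    by (rule card_thin_equivalent[OF mat_equivalent_transpose[OF assms(3) c] c' finite_carrier_vec3_bit])
  ultimately show ?thesis
    using k[OF assms(1)] k[OF assms(2)] by (elim disjE) (simp_all add: card_thin_M card_thin_transpose_M)
qed

section \<open>Primitive spaces attain all diagonals\<close>

lemma (in vec_space) span_nth_eq_0:
  assumes "S \<subseteq> carrier_vec n" "i < n" "\<And>v. v \<in> S \<Longrightarrow> v $ i = 0" "v \<in> span S"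
  shows "v $ i = 0"
proof -
  obtain a A where A: "v = lincomb a A" "A \<subseteq> S"
    using in_spanE[OF assms(4)] by metis
  then have "v $ i = (\<Sum>x\<in>A. a x * x $ i)"
    using assms(1,2) by (simp add: lincomb_index)
  also have "\<dots> = 0"
    using A(2) assms(3) by (intro sum.neutral) auto
  finally show ?thesis .
qed

lemma row_mat3_2: "row (mat3 a b c d e f g h i) 2 = vec3 g h i"
  and col_mat3_0: "col (mat3 a b c d e f g h i) 0 = vec3 a d g"
  by (intro eq_vecI; auto simp: less_3)+

lemma primitive_space_last_row:
  assumes "primitive_space 3 3 (V :: 'a :: field mat set)"
  shows "\<exists>M \<in> V. row M 2 \<noteq> 0\<^sub>v 3"
proof (rule ccontr)
  assume z: "\<not> ?thesis"
  interpret vec_space "TYPE('a)" 3 .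
  have V: "V \<subseteq> carrier_mat 3 3"
    using assms by (auto simp: primitive_space_def dest: mat_subspaceD(1))
  let ?S = "\<Union>M \<in> V. (\<lambda>x. M *\<^sub>v x) ` carrier_vec 3"
  have S: "span ?S = carrier_vec 3"
    using assms by (simp add: primitive_space_def)
  have 1: "?S \<subseteq> carrier_vec 3"
    using V by (auto intro: mult_mat_vec_carrier)
  have 2: "v $ 2 = 0" if v: "v \<in> ?S" for v
  proof -
    obtain M x where M: "M \<in> V" "x \<in> carrier_vec 3" "v = M *\<^sub>v x"
      using v by blast
    then have "v $ 2 = row M 2 \<bullet> x"
      using subsetD[OF V M(1)] by simp
    with M z show ?thesis
      by auto
  qed
  have "vec3 0 0 (1 :: 'a) $ 2 = 0"
    by (rule span_nth_eq_0[OF 1 _ 2]) (simp_all add: S)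
  then show False
    by simp
qed

lemma primitive_space_first_col:
  assumes "primitive_space 3 3 (V :: 'a :: field mat set)"
  shows "\<exists>M \<in> V. col M 0 \<noteq> 0\<^sub>v 3"
proof (rule ccontr)
  assume z: "\<not> ?thesis"
  have V: "V \<subseteq> carrier_mat 3 3"
    using assms by (auto simp: primitive_space_def dest: mat_subspaceD(1))
  have "vec3 1 0 0 \<in> mat_kernel M" if M: "M \<in> V" for M
  proof -
    have c: "M \<in> carrier_mat 3 3"
      using V M by auto
    have "M *\<^sub>v vec3 1 0 0 = col M 0"
      using c by (intro eq_vecI) (auto simp: scalar_prod_def sum_3)
    with z M have "M *\<^sub>v vec3 1 0 0 = 0\<^sub>v 3"
      by simp
    with c show ?thesis
      by (intro mat_kernelI) auto
  qed
  then have "\<exists>x \<in> carrier_vec 3. x \<noteq> 0\<^sub>v 3 \<and> (\<forall>M \<in> V. x \<in> mat_kernel M)"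
    by (intro bexI[of _ "vec3 1 0 0"]) (simp_all add: zero_vec3)
  moreover have "\<not> (\<exists>x \<in> carrier_vec 3. x \<noteq> 0\<^sub>v 3 \<and> (\<forall>M \<in> V. x \<in> mat_kernel M))"
    using assms unfolding primitive_space_def by (elim conjE)
  ultimately show False
    by contradiction
qed

text \<open>A change of the middle entry, which costs at most one in rank, makes the matrix unitriangular and
  hence of rank 3.\<close>

lemma rank_ge_2_corner_ones:
  "vec_space.rank 3 (mat3 1 x y 0 0 z 0 0 (1 :: 'a :: field)) \<ge> 2"
proof -
  interpret vec_space "TYPE('a)" 3 .
  let ?M = "mat3 1 x y 0 0 z 0 0 1" and ?E = "mat3 0 0 0 0 1 0 0 0 (0 :: 'a)"
  have "det (?M + ?E) = prod_list (diag_mat (?M + ?E))"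
    by (rule det_upper_triangular[of _ 3]) (auto simp: upper_triangular_def less_3 less_2_cases_iff)
  also have "\<dots> = 1"
    by (simp add: diag_mat_def upt_rec mat3_index(9)[unfolded numeral_2_eq_2])
  finally have "rank (?M + ?E) = 3"
    by (intro low_rank_det_zero) auto
  moreover have "rank (?M + ?E) \<le> rank ?M + rank ?E"
    by (rule rank_subadditive) auto
  moreover have "rank ?E \<le> 1"
    by (rule rank_le_1_product_entries[of _ 3 "\<lambda>i. of_bool (i = 1)" "\<lambda>i. of_bool (i = 1)"]) (auto simp: less_3)
  ultimately show ?thesis
    by linarith
qed

text \<open>If the middle diagonal entry vanished on \<open>V\<close>, all matrices would have diagonal \<open>(a, 0, a)\<close>, and after
  deletion of the last column only the first row could be non-zero. Some matrix has \<open>a = 1\<close>, since the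
  last row does not vanish on \<open>V\<close>, and that matrix has rank at least 2.\<close>

lemma primitive_space_middle:
  assumes "primitive_space 3 3 V" "V \<subseteq> J3"
  shows "\<exists>M \<in> V. M $$ (1, 1) = 1"
proof (rule ccontr)
  assume z: "\<not> ?thesis"
  have form: "\<exists>a x y z. M = mat3 a x y 0 0 z 0 0 a" if M: "M \<in> V" for M
  proof -
    obtain a b x y z where *: "M = mat3 a x y 0 (a + b) z 0 0 b"
      by (rule J3E[OF subsetD[OF assms(2) M]])
    with z M have "a + b = 0"
      by auto
    then have "b = a"
      by (metis add.right_neutral bit_add_self(2))
    with * show ?thesis
      by (auto simp: bit_add_self)
  qed
  have V: "V \<subseteq> carrier_mat 3 3" "finite V" "V \<noteq> {}"
    using assms finite_subset[OF assms(2) finite_J3]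
    by (auto simp: primitive_space_def dest: mat_subspaceD(1,2))
  obtain M where M: "M \<in> V" "row M 2 \<noteq> 0\<^sub>v 3"
    using primitive_space_last_row[OF assms(1)] by blast
  then obtain a x y z where Ma: "M = mat3 a x y 0 0 z 0 0 a"
    using form by blast
  with M(2) have "a \<noteq> 0"
    by (auto simp: row_mat3_2 zero_vec3)
  then have "vec_space.rank 3 M \<ge> 2"
    using rank_ge_2_corner_ones[of x y z] Ma by simp
  moreover have "vec_space.rank 3 M \<le> urk 3 V"
    unfolding urk_def using V M by (intro Max_ge) auto
  moreover have "urk 3 (drop_last_col ` V) \<le> 1"
    unfolding urk_def
  proof (rule Max.boundedI)
    fix r assume "r \<in> vec_space.rank 3 ` drop_last_col ` V"
    then obtain N where N: "N \<in> V" "r = vec_space.rank 3 (drop_last_col N)"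
      by auto
    obtain a x y z where Na: "N = mat3 a x y 0 0 z 0 0 a"
      using form[OF N(1)] by blast
    have "drop_last_col N \<in> carrier_mat 3 2"
      by (simp add: drop_last_col_def Na)
    then show "r \<le> 1"
      unfolding N(2)
      by (rule vec_space.rank_le_1_product_entries[of _ _ _ "\<lambda>i. of_bool (i = 0)" "\<lambda>j. if j = 0 then a else x"])
        (auto simp: drop_last_col_def Na less_3 less_2_cases_iff)
  qed (use V in auto)
  ultimately have "urk 3 (drop_last_col ` V) < urk 3 V"
    by linarith
  then have "\<exists>T. mat_equivalent 3 3 V T \<and> urk 3 (drop_last_col ` T) < urk 3 V"
    using mat_equivalent_refl[OF V(1)] by (intro exI conjI)
  moreover have "\<not> (\<exists>T. mat_equivalent 3 3 V T \<and> urk 3 (drop_last_col ` T) < urk 3 V)"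
    using assms(1) unfolding primitive_space_def by (elim conjE)
  ultimately show False
    by contradiction
qed

text \<open>The pairs \<open>(a, b)\<close> that occur form an additive subgroup of the four-element group on which none of
  the three non-zero linear forms vanishes; only the whole group has this property.\<close>

lemma primitive_space_diagonals:
  assumes "primitive_space 3 3 V" "V \<subseteq> J3"
  shows "\<exists>x y z. mat3 a x y 0 (a + b) z 0 0 b \<in> V"
proof -
  define D where "D a b \<longleftrightarrow> (\<exists>x y z. mat3 a x y 0 (a + b) z 0 0 b \<in> V)" for a b
  have V: "mat_subspace 3 3 V"
    using assms(1) by (simp add: primitive_space_def)
  have form: "\<exists>a b. D a b \<and> M $$ (1, 1) = a + b \<and> row M 2 = vec3 0 0 b \<and> col M 0 = vec3 a 0 0"
    if M: "M \<in> V" for M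
  proof -
    obtain a b x y z where *: "M = mat3 a x y 0 (a + b) z 0 0 b"
      by (rule J3E[OF subsetD[OF assms(2) M]])
    moreover from M * have "D a b"
      unfolding D_def by blast
    ultimately show ?thesis
      by (intro exI[of _ a] exI[of _ b]) (simp add: row_mat3_2 col_mat3_0)
  qed
  have add: "D (a + a') (b + b')" if D: "D a b" "D a' b'" for a b a' b'
  proof -
    obtain x y z x' y' z' where
      "mat3 a x y 0 (a + b) z 0 0 b \<in> V" "mat3 a' x' y' 0 (a' + b') z' 0 0 b' \<in> V"
      using D unfolding D_def by blast
    from mat_subspaceD(3)[OF V this] show ?thesis
      unfolding D_def by (simp add: add_ac) blast
  qed
  have "D 1 0 \<or> D 1 1"
  proof -
    obtain M where M: "M \<in> V" "col M 0 \<noteq> 0\<^sub>v 3"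
      using primitive_space_first_col[OF assms(1)] by blast
    then obtain a b where "D a b" "a \<noteq> 0"
      using form[OF M(1)] by (auto simp: zero_vec3)
    then show ?thesis
      by (cases b) auto
  qed
  moreover have "D 0 1 \<or> D 1 1"
  proof -
    obtain M where M: "M \<in> V" "row M 2 \<noteq> 0\<^sub>v 3"
      using primitive_space_last_row[OF assms(1)] by blast
    then obtain a b where "D a b" "b \<noteq> 0"
      using form[OF M(1)] by (auto simp: zero_vec3)
    then show ?thesis
      by (cases a) auto
  qed
  moreover have "D 1 0 \<or> D 0 1"
  proof -
    obtain M where M: "M \<in> V" "M $$ (1, 1) = 1"
      using primitive_space_middle[OF assms] by blast
    then obtain a b where "D a b" "a + b = 1"
      using form[OF M(1)] by auto
    then show ?thesis
      by (cases a; cases b) auto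
  qed
  moreover have "D 1 1 \<Longrightarrow> D 1 0 \<Longrightarrow> D 0 1" "D 1 1 \<Longrightarrow> D 0 1 \<Longrightarrow> D 1 0"
    "D 1 0 \<Longrightarrow> D 0 1 \<Longrightarrow> D 1 1" "D 1 0 \<Longrightarrow> D 0 0"
    using add[of 1 1 1 0] add[of 1 1 0 1] add[of 1 0 0 1] add[of 1 0 1 0] by simp_all
  ultimately have "D 0 0 \<and> D 0 1 \<and> D 1 0 \<and> D 1 1"
    by blast
  then have "D a b"
    by (cases a; cases b) simp_all
  then show ?thesis
    by (simp only: D_def)
qed

text \<open>Matrices \<open>A\<close> and \<open>B\<close> of \<open>V\<close> with diagonals \<open>(1,1,0)\<close> and \<open>(0,1,1)\<close> split every element as
  \<open>a A + b B + Z\<close> with \<open>Z\<close> of zero diagonal. The eight elements of \<open>V\<close> are thus four times the number of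
  possible \<open>Z\<close>, so exactly one \<open>Z\<close> is non-zero, and it serves as \<open>N\<close>.\<close>

lemma primitive_eq_upper_family:
  assumes "primitive_space 3 3 V" "V \<subseteq> J3" "mat_space_dim 3 3 V = 3"
  shows "\<exists>l1 l2 k1 k2 m1 m2 n1 n2 n3. (n1, n2, n3) \<noteq> (0, 0, 0) \<and>
    V = associated_space (upper_family l1 l2 k1 k2 m1 m2 n1 n2 n3)"
proof -
  have V: "mat_subspace 3 3 V"
    using assms(1) by (simp add: primitive_space_def)
  note add = mat_subspaceD(3)[OF V] and smult = mat_subspaceD(4)[OF V]
  obtain l1 k1 m1 where A: "mat3 1 l1 k1 0 1 m1 0 0 0 \<in> V"
    using primitive_space_diagonals[OF assms(1,2), of 1 0] by auto
  obtain l2 k2 m2 where B: "mat3 0 l2 k2 0 1 m2 0 0 1 \<in> V"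
    using primitive_space_diagonals[OF assms(1,2), of 0 1] by auto
  define K where "K = {(x, y, z). mat3 0 x y 0 0 z 0 0 (0 :: bit) \<in> V}"
  let ?f = "\<lambda>(a, b, x, y, z). mat3 a (l1 * a + l2 * b + x) (k1 * a + k2 * b + y)
    0 (a + b) (m1 * a + m2 * b + z) 0 0 b"
  have AB: "mat3 a (l1 * a + l2 * b) (k1 * a + k2 * b) 0 (a + b) (m1 * a + m2 * b) 0 0 b \<in> V" for a b
    using add[OF smult[OF A, of a] smult[OF B, of b]] by (simp add: mult.commute)
  have f: "V = ?f ` (UNIV \<times> UNIV \<times> K)"
  proof (intro equalityI subsetI)
    fix M assume M: "M \<in> V"
    then obtain a b x y z where *: "M = mat3 a x y 0 (a + b) z 0 0 b"
      by (auto elim: J3E[OF subsetD[OF assms(2)]])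
    let ?x = "x + (l1 * a + l2 * b)" and ?y = "y + (k1 * a + k2 * b)" and ?z = "z + (m1 * a + m2 * b)"
    have "(?x, ?y, ?z) \<in> K"
      using add[OF M AB[of a b]] by (simp add: K_def * bit_add_self)
    moreover have "u + (w + u) = w" for u w :: bit
      by (simp add: add.left_commute bit_add_self)
    then have "M = ?f (a, b, ?x, ?y, ?z)"
      by (simp add: *)
    ultimately show "M \<in> ?f ` (UNIV \<times> UNIV \<times> K)"
      by (intro image_eqI[where x = "(a, b, ?x, ?y, ?z)"]) auto
  next
    fix M assume "M \<in> ?f ` (UNIV \<times> UNIV \<times> K)"
    then obtain a b x y z where *: "(x, y, z) \<in> K" "M = ?f (a, b, x, y, z)"
      by auto
    then show "M \<in> V"
      using add[OF AB[of a b], of "mat3 0 x y 0 0 z 0 0 0"] by (simp add: K_def)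
  qed
  have "card V = 2 ^ 3"
    using card_mat_subspace[OF V finite_subset[OF assms(2) finite_J3]] assms(3) by simp
  moreover have "card V = card (UNIV \<times> UNIV \<times> K :: (bit \<times> bit \<times> bit \<times> bit \<times> bit) set)"
    unfolding f by (rule card_image) (auto simp: inj_on_def)
  ultimately have "card K = 2"
    by (simp add: card_cartesian_product bit_card)
  moreover have "(0, 0, 0) \<in> K"
    using mat_subspaceD(2)[OF V] by (simp add: K_def zero_mat3)
  ultimately obtain n where n: "n \<noteq> (0, 0, 0)" "K = {(0, 0, 0), n}"
    unfolding card_2_iff by (metis doubleton_eq_iff insertE singletonD)
  obtain n1 n2 n3 where n_def: "n = (n1, n2, n3)"
    by (cases n)
  have K: "K = range (\<lambda>c. (n1 * c, n2 * c, n3 * c))"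
    unfolding n n_def by (auto simp: image_iff ex_bit)
  have "V = associated_space (upper_family l1 l2 k1 k2 m1 m2 n1 n2 n3)"
    unfolding f K associated_space_def upper_family_def by (auto simp: image_iff) 
  then show ?thesis
    using n(1) n_def by blast
qed

section \<open>Classification\<close>

theorem proposition4p2:
  fixes V :: "bit mat set"
  assumes "primitive_space 3 3 V"
    and "V \<subseteq> J3"
    and "mat_space_dim 3 3 V = 3"
  shows "\<exists>!k. k < 4 \<and> mat_equivalent 3 3 V (associated_space ([M1, M2, M3, M4] ! k))"
proof -
  let ?S = "\<lambda>k. associated_space ([M1, M2, M3, M4] ! k)"
  obtain l1 l2 k1 k2 m1 m2 n1 n2 n3 where
    n: "(n1, n2, n3) \<noteq> (0, 0, 0)" and V: "V = associated_space (upper_family l1 l2 k1 k2 m1 m2 n1 n2 n3)"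
    using primitive_eq_upper_family[OF assms] by blast
  have c: "V \<subseteq> carrier_mat 3 3"
    unfolding V by (rule associated_space_carrier)
  \<comment> \<open>The reduction changes only the corner, and by a combination of the other two entries, so \<open>N\<close>
    stays non-zero.\<close>
  from n have "(n1, n2 + l2 * n3 + m1 * n1, n3) \<noteq> (0, 0, 0)"
    by auto
  then obtain k where k: "k < 4"
    "mat_equivalent 3 3 (associated_space (upper_family 0 0 0 0 0 0 n1 (n2 + l2 * n3 + m1 * n1) n3)) (?S k)"
    using diagonal_equivalent_M by blast
  have "mat_equivalent 3 3 V (?S k)"
    using mat_equivalent_trans[OF upper_family_equivalent_diagonal k(2) associated_space_carrier(5)] unfolding V .
  moreover have "i = j" if "i < 4" "j < 4" "mat_equivalent 3 3 V (?S i)" "mat_equivalent 3 3 V (?S j)" for i j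
    using mat_equivalent_trans[OF mat_equivalent_sym[OF that(3) c] that(4) mat_equivalent_carrier[OF that(3) c]]
      M_inequivalent that(1,2) by blast
  ultimately show ?thesis
    using k(1) by blast
qed

end
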